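(* If the characteristic of the field $\mathbb{K}$ is either $0$ or greater than $3^{\varphi(n^2-n)}$, where $\varphi$ is Euler's totient function, then there exists no $5$-net of order $n$ embedded in the projective plane $PG(2,\mathbb{K})$.
   Context: $PG(2,\mathbb{K})$ is the projective plane over the field $\mathbb{K}$. A $k$-net of order $n$ embedded in $PG(2,\mathbb{K})$ is a $k$-tuple $\lambda=(\lambda_1,\ldots,\lambda_k)$ of pairwise disjoint sets of lines of $PG(2,\mathbb{K})$ (called components), each of the same size $n$, such that any two lines from distinct components are concurrent with exactly one line from each component: if $\ell\in\lambda_i$, $m\in\lambda_j$ with $i\neq j$, then through the point $\ell\cap m$ there passes exactly one line of each of $\lambda_1,\ldots,\lambda_k$. The points of the net are the $n^2$ points $\ell\cap m$ of this kind. *)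

theory Defs
  imports "HOL-Analysis.Analysis" "HOL-Number_Theory.Number_Theory"
begin

text \<open>
  $PG(2,K)$ is the projective space of the vector space $K^3$: its points and lines are the
  linear subspaces of dimension 1 and 2, and incidence is inclusion.
\<close>

definition pg_points :: "('a::field ^ 3) set set" where
  "pg_points = {P. vec.subspace P \<and> vec.dim P = 1}"

definition pg_lines :: "('a::field ^ 3) set set" where
  "pg_lines = {l. vec.subspace l \<and> vec.dim l = 2}"

text \<open>
  The components are \<open>lam 0, \<dots>, lam (k - 1)\<close>; values of \<open>lam\<close> at indices \<open>\<ge> k\<close> are irrelevant.
  Lines of distinct components are distinct, so the point \<open>P\<close> below is the unique common point
  of \<open>l\<close> and \<open>m\<close>. The degenerate orders 0 and 1 are not excluded here.
\<close>

definition embedded_net :: "nat \<Rightarrow> nat \<Rightarrow> (nat \<Rightarrow> ('a::field ^ 3) set set) \<Rightarrow> bool" where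
  "embedded_net k n lam \<longleftrightarrow>
     (\<forall>i<k. lam i \<subseteq> pg_lines \<and> finite (lam i) \<and> card (lam i) = n) \<and>
     (\<forall>i<k. \<forall>j<k. i \<noteq> j \<longrightarrow> lam i \<inter> lam j = {}) \<and>
     (\<forall>i<k. \<forall>j<k. i \<noteq> j \<longrightarrow>
        (\<forall>l\<in>lam i. \<forall>m\<in>lam j.
           \<exists>P\<in>pg_points. P \<subseteq> l \<and> P \<subseteq> m \<and> (\<forall>t<k. \<exists>!h. h \<in> lam t \<and> P \<subseteq> h)))"

end

theory Submission
  imports Defs "Jordan_Normal_Form.Char_Poly"
begin

text \<open>
  On a line of component \<open>r\<close> the linear forms of the lines of two other components \<open>i\<close> and \<open>j\<close>
  vanish at the same points, so the products of these forms are proportional there; two lines of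
  component \<open>r\<close> meet outside the net, so the factor does not depend on the line. It follows that
  the cross-ratio \<open>\<kappa>\<close> of the lines of four components through a net point is the same at all
  points, and taking the product over all points gives \<open>\<kappa> ^ (n\<^sup>2 - n) = 1\<close>. Since \<open>1 - \<kappa>\<close> is the
  cross-ratio for another order of the components, also \<open>(1 - \<kappa>) ^ (n\<^sup>2 - n) = 1\<close>. Lifting both
  roots of unity to the complex numbers, the norm of \<open>1 - \<zeta> ^ i - \<zeta> ^ j\<close> is an integer of absolute
  value at most \<open>3 ^ \<phi>(n\<^sup>2 - n)\<close> that vanishes in the field, hence is \<open>0\<close>, which forces
  \<open>\<kappa>\<^sup>2 - \<kappa> + 1 = 0\<close>. For five components the cross-ratios \<open>u\<close>, \<open>v\<close> and \<open>u v\<close> would all satisfy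
  this equation, which is impossible unless \<open>2 = 0\<close>.
\<close>

section \<open>Lines and linear forms\<close>

text \<open>A basis of \<open>l\<close> extends by a single vector \<open>u\<close> to a basis of
  the whole space; the coordinate at \<open>u\<close> is such a form.\<close>

lemma line_eq_kernel:
  fixes l :: "('a::field ^ 3) set"
  assumes "l \<in> pg_lines"
  shows "\<exists>f :: 'a ^ 3 \<Rightarrow> 'a. (\<forall>x y. f (x + y) = f x + f y) \<and> (\<forall>c x. f (c *s x) = c * f x)
    \<and> (\<forall>x. f x = 0 \<longleftrightarrow> x \<in> l)"
proof -
  have l: "vec.subspace l" "vec.dim l = 2" using assms by (auto simp: pg_lines_def)
  obtain B where B: "B \<subseteq> l" "vec.independent B" "l \<subseteq> vec.span B" "card B = vec.dim l"
    using vec.basis_exists by blast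
  have span_B: "vec.span B = l"
    using B l(1) by (metis vec.span_minimal subset_antisym)
  define B' where "B' = vec.extend_basis B"
  have B': "vec.independent B'" "vec.span B' = UNIV" "B \<subseteq> B'"
    using vec.independent_extend_basis[OF B(2)] vec.span_extend_basis[OF B(2)]
      vec.extend_basis_superset[OF B(2)] by (auto simp: B'_def)
  have fin: "finite B'" using vec.finiteI_independent B'(1) by blast
  have "card B' = vec.dim (UNIV :: ('a ^ 3) set)"
    using vec.dim_eq_card[OF _ B'(1), of UNIV] B'(2) by simp
  hence "card B' = 3" by (simp only: vec_dim_card) simp
  moreover have "card (B' - B) = card B' - card B"
    using B'(3) fin finite_subset by (intro card_Diff_subset) auto
  ultimately have "card (B' - B) = 1" using B(4) l(2) by simp
  then obtain u where u: "B' - B = {u}" by (auto simp: card_1_singleton_iff)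
  define f where "f = (\<lambda>x. vec.representation B' x u)"
  have "f (x + y) = f x + f y" for x y
    unfolding f_def using vec.representation_add[OF B'(1)] B'(2) by auto
  moreover have "f (c *s x) = c * f x" for c x
    unfolding f_def using vec.representation_scale[OF B'(1)] B'(2) by auto
  moreover have "f x = 0 \<longleftrightarrow> x \<in> l" for x
  proof
    assume "x \<in> l"
    hence "vec.representation B' x = vec.representation B x"
      using vec.representation_extend[OF B'(1) _ B'(3)] span_B by auto
    moreover have "u \<notin> B" using u by auto
    ultimately show "f x = 0" unfolding f_def using vec.representation_ne_zero[of B x u] by auto
  next
    assume 0: "f x = 0"
    have "x = (\<Sum>b\<in>B'. vec.representation B' x b *s b)"
      using vec.sum_representation_eq[OF B'(1) _ fin order_refl, of x] B'(2) by simp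
    also have "\<dots> = (\<Sum>b\<in>B. vec.representation B' x b *s b)"
    proof (rule sum.mono_neutral_right[OF fin B'(3)], rule ballI)
      fix b assume "b \<in> B' - B"
      hence "b = u" using u by auto
      thus "vec.representation B' x b *s b = 0" using 0 by (simp add: f_def)
    qed
    also have "\<dots> \<in> vec.span B"
      by (intro vec.span_sum vec.span_scale vec.span_base)
    finally show "x \<in> l" using span_B by simp
  qed
  ultimately show ?thesis by (intro exI[of _ f] conjI allI)
qed

text \<open>The form is determined only up to a nonzero scalar. The arbitrary choice is harmless: at
  a fixed point it rescales \<open>ratio i j r\<close> by a factor that does not depend on
  \<open>r\<close>, and this cancels in \<open>cross\<close>.\<close>

definition line_form :: "('a::field ^ 3) set \<Rightarrow> 'a ^ 3 \<Rightarrow> 'a" where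
  "line_form l = (SOME f. (\<forall>x y. f (x + y) = f x + f y) \<and> (\<forall>c x. f (c *s x) = c * f x)
    \<and> (\<forall>x. f x = 0 \<longleftrightarrow> x \<in> l))"

lemma
  assumes "l \<in> pg_lines"
  shows line_form_add: "line_form l (x + y) = line_form l x + line_form l y"
    and line_form_scale: "line_form l (c *s x) = c * line_form l x"
    and line_form_eq_0_iff: "line_form l x = 0 \<longleftrightarrow> x \<in> l"
  using someI_ex[OF line_eq_kernel[OF assms], folded line_form_def] by auto

lemma line_form_diff:
  assumes "l \<in> pg_lines"
  shows "line_form l (x - y) = line_form l x - line_form l y"
  using line_form_add[OF assms, of "x - y" y] by simp

section \<open>Incidence of points and lines\<close>

lemma pg_lines_inter_eq_point:
  assumes "l \<in> pg_lines" "m \<in> pg_lines" "l \<noteq> m" "P \<in> pg_points" "P \<subseteq> l" "P \<subseteq> m"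
  shows "l \<inter> m = P"
proof -
  have l: "vec.subspace l" "vec.dim l = 2" and m: "vec.subspace m" "vec.dim m = 2"
    using assms by (auto simp: pg_lines_def)
  have P: "vec.subspace P" "vec.dim P = 1" using assms by (auto simp: pg_points_def)
  have s: "vec.subspace (l \<inter> m)" using l m by (simp add: vec.subspace_inter)
  have "vec.dim (l \<inter> m) \<noteq> 2"
  proof
    assume d: "vec.dim (l \<inter> m) = 2"
    have "l \<inter> m = l" using d l s by (intro vec.subspace_dim_equal) auto
    moreover have "l \<inter> m = m" using d m s by (intro vec.subspace_dim_equal) auto
    ultimately show False using assms(3) by simp
  qed
  moreover have "vec.dim (l \<inter> m) \<le> 2" using vec.dim_subset[of "l \<inter> m" l] l(2) by simp
  ultimately have "vec.dim (l \<inter> m) \<le> vec.dim P" using P by simp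
  hence "P = l \<inter> m" using assms P s by (intro vec.subspace_dim_equal) auto
  thus ?thesis by simp
qed

lemma pg_point_nonzero:
  assumes "P \<in> pg_points"
  obtains p where "p \<in> P" "p \<noteq> 0"
proof -
  have "vec.dim P = 1" "vec.subspace P" using assms by (auto simp: pg_points_def)
  hence "\<not> P \<subseteq> {0}" using vec.dim_eq_0[of P] by auto
  thus ?thesis using that by auto
qed

lemma pg_point_eq_span:
  assumes "P \<in> pg_points" "p \<in> P" "p \<noteq> 0"
  shows "P = vec.span {p}"
proof -
  have P: "vec.dim P = 1" "vec.subspace P" using assms by (auto simp: pg_points_def)
  have "vec.dim (vec.span {p}) = 1"
    using vec.dim_span_eq_card_independent[of "{p}"] assms(3) by simp
  moreover have "vec.span {p} \<subseteq> P" using assms(2) P(2) by (simp add: vec.span_minimal)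
  ultimately show ?thesis using P by (metis order_refl vec.subspace_dim_equal vec.subspace_span)
qed

lemma pg_point_subset_line_iff:
  assumes "P \<in> pg_points" "p \<in> P" "p \<noteq> 0" "l \<in> pg_lines"
  shows "P \<subseteq> l \<longleftrightarrow> p \<in> l"
proof
  assume "p \<in> l"
  moreover have "vec.subspace l" using assms by (auto simp: pg_lines_def)
  ultimately show "P \<subseteq> l" unfolding pg_point_eq_span[OF assms(1-3)] by (simp add: vec.span_minimal)
qed (use assms in auto)

text \<open>The form of \<open>m\<close> cannot be injective on a two-dimensional space: for a basis
  \<open>u\<close>, \<open>v\<close> of \<open>l\<close> it kills either \<open>u\<close> or a
  nonzero combination of both.\<close>

lemma pg_lines_meet:
  assumes "l \<in> pg_lines" "m \<in> pg_lines"
  obtains p where "p \<in> l" "p \<in> m" "p \<noteq> 0"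
proof -
  have l: "vec.subspace l" "vec.dim l = 2"
    using assms by (auto simp: pg_lines_def)
  obtain B where B: "B \<subseteq> l" "vec.independent B" "l \<subseteq> vec.span B" "card B = vec.dim l"
    using vec.basis_exists by blast
  then obtain u v where uv: "B = {u, v}" "u \<noteq> v" using l(2) by (auto simp: card_2_iff)
  let ?f = "line_form m"
  note add = line_form_add[OF assms(2)] and scale = line_form_scale[OF assms(2)]
    and iff = line_form_eq_0_iff[OF assms(2)]
  have u0: "u \<noteq> 0" using B(2) uv vec.dependent_zero by blast
  show ?thesis
  proof (cases "?f u = 0")
    case True
    thus ?thesis using that[of u] u0 uv B(1) iff by auto
  next
    case False
    let ?p = "?f v *s u - ?f u *s v"
    have "?f ?p = 0" by (simp add: line_form_diff[OF assms(2)] scale)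
    moreover have "?p \<in> l" using B(1) uv l(1)
      by (intro vec.subspace_diff vec.subspace_scale) auto
    moreover have "?p \<noteq> 0"
    proof
      assume "?p = 0"
      hence "?f u *s v = ?f v *s u" by simp
      hence "v = (?f v / ?f u) *s u"
        using False by (metis (no_types, lifting) divide_inverse_commute vec.scale_one vec.scale_scale
          left_inverse)
      hence "v \<in> vec.span {u}" by (metis insertI1 vec.span_base vec.span_scale)
      thus False using B(2) uv vec.independent_insert[of v "{u}"] by (simp add: insert_commute)
    qed
    ultimately show ?thesis using that iff by blast
  qed
qed

text \<open>Restricted to the two-dimensional space \<open>m\<close>, both forms have kernel
  \<open>P\<close>, so their values at one vector \<open>e\<close> of \<open>m\<close> outside
  \<open>P\<close> determine the factor.\<close>

lemma line_forms_proportional: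
  assumes "l \<in> pg_lines" "m \<in> pg_lines" "h \<in> pg_lines" "P \<in> pg_points"
    and "P \<subseteq> l" "P \<subseteq> m" "P \<subseteq> h" "l \<noteq> m" "h \<noteq> m"
  obtains c where "c \<noteq> 0" "\<And>x. x \<in> m \<Longrightarrow> line_form l x = c * line_form h x"
proof -
  have m: "vec.subspace m" using assms(2) by (simp add: pg_lines_def)
  have lm: "l \<inter> m = P" and hm: "h \<inter> m = P"
    using pg_lines_inter_eq_point[OF assms(1,2,8,4,5,6)]
      pg_lines_inter_eq_point[OF assms(3,2,9,4,7,6)] .
  have "m \<noteq> P" using assms(2,4) by (auto simp: pg_lines_def pg_points_def)
  then obtain e where e: "e \<in> m" "e \<notin> P" using assms(6) by auto
  have ne: "line_form l e \<noteq> 0" "line_form h e \<noteq> 0"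
    using e lm hm assms by (auto simp: line_form_eq_0_iff)
  show ?thesis
  proof
    show "line_form l e / line_form h e \<noteq> 0" using ne by simp
    fix x assume x: "x \<in> m"
    let ?d = "x - (line_form h x / line_form h e) *s e"
    have "?d \<in> m" using x e m by (intro vec.subspace_diff vec.subspace_scale) auto
    moreover have "line_form h ?d = 0"
      using ne by (simp add: line_form_diff[OF assms(3)] line_form_scale[OF assms(3)])
    ultimately have "?d \<in> l" using lm hm assms(3) by (auto simp: line_form_eq_0_iff)
    hence "line_form l ?d = 0" using assms(1) by (simp add: line_form_eq_0_iff)
    thus "line_form l x = line_form l e / line_form h e * line_form h x"
      by (simp add: line_form_diff[OF assms(1)] line_form_scale[OF assms(1)])
  qed
qed

section \<open>Cross-ratios of an embedded net\<close>

locale net =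
  fixes k n :: nat and lam :: "nat \<Rightarrow> ('a::field ^ 3) set set"
  assumes net: "embedded_net k n lam" and n_pos: "n > 0"
begin

section \<open>Net points and the lines through them\<close>

lemma lam_lines: "i < k \<Longrightarrow> l \<in> lam i \<Longrightarrow> l \<in> pg_lines"
  and finite_lam: "i < k \<Longrightarrow> finite (lam i)"
  and card_lam: "i < k \<Longrightarrow> card (lam i) = n"
  and lam_disjoint: "i < k \<Longrightarrow> j < k \<Longrightarrow> i \<noteq> j \<Longrightarrow> l \<in> lam i \<Longrightarrow> l \<notin> lam j"
proof -
  note * = net[unfolded embedded_net_def]
  note 1 = conjunct1[OF *] and 2 = conjunct1[OF conjunct2[OF *]]
  show "i < k \<Longrightarrow> l \<in> lam i \<Longrightarrow> l \<in> pg_lines" using 1 by (simp add: subset_iff)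
  show "i < k \<Longrightarrow> finite (lam i)" "i < k \<Longrightarrow> card (lam i) = n" using 1 by simp_all
  show "i < k \<Longrightarrow> j < k \<Longrightarrow> i \<noteq> j \<Longrightarrow> l \<in> lam i \<Longrightarrow> l \<notin> lam j"
    using 2 by (simp add: disjoint_iff)
qed

text \<open>For \<open>k\<close> at least 2 these are exactly the intersections of lines of distinct
  components. Phrased through unique lines, membership is what makes \<open>line_thr\<close> well
  defined.\<close>

definition net_points :: "('a ^ 3) set set" where
  "net_points = {P \<in> pg_points. \<forall>t<k. \<exists>!h. h \<in> lam t \<and> P \<subseteq> h}"

definition line_thr :: "nat \<Rightarrow> ('a ^ 3) set \<Rightarrow> ('a ^ 3) set" where
  "line_thr t P = (THE h. h \<in> lam t \<and> P \<subseteq> h)"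

lemma net_points_pg_points: "P \<in> net_points \<Longrightarrow> P \<in> pg_points"
  by (simp add: net_points_def)

lemma
  assumes "P \<in> net_points" "t < k"
  shows line_thr_in_lam: "line_thr t P \<in> lam t" and subset_line_thr: "P \<subseteq> line_thr t P"
    and line_thr_unique: "h \<in> lam t \<Longrightarrow> P \<subseteq> h \<Longrightarrow> line_thr t P = h"
proof -
  have ex: "\<exists>!h. h \<in> lam t \<and> P \<subseteq> h" using assms by (auto simp: net_points_def)
  show "line_thr t P \<in> lam t" "P \<subseteq> line_thr t P" using theI'[OF ex] by (auto simp: line_thr_def)
  thus "h \<in> lam t \<Longrightarrow> P \<subseteq> h \<Longrightarrow> line_thr t P = h" using ex by blast
qed

lemma line_thr_pg_line: "P \<in> net_points \<Longrightarrow> t < k \<Longrightarrow> line_thr t P \<in> pg_lines"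
  using line_thr_in_lam lam_lines by blast

lemma line_thr_distinct: "P \<in> net_points \<Longrightarrow> s < k \<Longrightarrow> t < k \<Longrightarrow> s \<noteq> t \<Longrightarrow> line_thr s P \<noteq> line_thr t P"
  using lam_disjoint[of s t "line_thr s P"] line_thr_in_lam[of P s] line_thr_in_lam[of P t] by auto

lemma inter_in_net_points:
  assumes "i < k" "j < k" "i \<noteq> j" "l \<in> lam i" "m \<in> lam j"
  shows "l \<inter> m \<in> net_points"
proof -
  obtain P where P: "P \<in> pg_points" "P \<subseteq> l" "P \<subseteq> m" "\<forall>t<k. \<exists>!h. h \<in> lam t \<and> P \<subseteq> h"
    using conjunct2[OF conjunct2[OF net[unfolded embedded_net_def]], rule_format, OF assms]
    by (elim bexE conjE)
  moreover have "l \<inter> m = P"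
    using P assms lam_lines[OF assms(1,4)] lam_lines[OF assms(2,5)] lam_disjoint[OF assms(1-4)]
    by (intro pg_lines_inter_eq_point) auto
  ultimately show ?thesis by (simp add: net_points_def)
qed

lemma line_thr_inter:
  assumes "P \<in> net_points" "i < k" "j < k" "i \<noteq> j"
  shows "line_thr i P \<inter> line_thr j P = P"
  by (rule pg_lines_inter_eq_point[OF line_thr_pg_line[OF assms(1,2)] line_thr_pg_line[OF assms(1,3)]
        line_thr_distinct[OF assms] net_points_pg_points[OF assms(1)] subset_line_thr[OF assms(1,2)]
        subset_line_thr[OF assms(1,3)]])

lemma
  assumes "i < k" "j < k" "i \<noteq> j" "l \<in> lam i" "m \<in> lam j"
  shows line_thr_inter_left: "line_thr i (l \<inter> m) = l" and line_thr_inter_right: "line_thr j (l \<inter> m) = m"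
  using line_thr_unique[OF inter_in_net_points[OF assms]] assms by simp_all

lemma bij_betw_net_points:
  assumes "i < k" "j < k" "i \<noteq> j"
  shows "bij_betw (\<lambda>P. (line_thr i P, line_thr j P)) net_points (lam i \<times> lam j)"
proof (rule bij_betw_byWitness[where f' = "\<lambda>(l, m). l \<inter> m"])
  show "\<forall>P\<in>net_points. (case (line_thr i P, line_thr j P) of (l, m) \<Rightarrow> l \<inter> m) = P"
    using assms by (auto simp: line_thr_inter)
  show "\<forall>lm\<in>lam i \<times> lam j. (line_thr i (case lm of (l, m) \<Rightarrow> l \<inter> m), line_thr j (case lm of (l, m) \<Rightarrow> l \<inter> m)) = lm"
    using assms by (auto simp: line_thr_inter_left line_thr_inter_right)
  show "(\<lambda>P. (line_thr i P, line_thr j P)) ` net_points \<subseteq> lam i \<times> lam j"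
    using assms by (auto simp: line_thr_in_lam)
  show "(\<lambda>(l, m). l \<inter> m) ` (lam i \<times> lam j) \<subseteq> net_points"
    using assms inter_in_net_points by auto
qed

lemma
  assumes "i < k" "j < k" "i \<noteq> j"
  shows finite_net_points: "finite net_points" and card_net_points: "card net_points = n * n"
proof -
  note b = bij_betw_net_points[OF assms]
  show "finite net_points" using bij_betw_finite[OF b] assms finite_lam by simp
  show "card net_points = n * n"
    using bij_betw_same_card[OF b] assms by (simp add: card_cartesian_product card_lam)
qed

text \<open>Turns a product over component \<open>j\<close> into a product over the net points of a
  single line \<open>m\<close>; intersecting with \<open>m\<close> is the inverse map.\<close>

lemma bij_betw_line_thr:
  assumes "i < k" "j < k" "i \<noteq> j" "m \<in> lam i"
  shows "bij_betw (line_thr j) {P \<in> net_points. P \<subseteq> m} (lam j)"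
proof (rule bij_betw_byWitness[where f' = "\<lambda>l. m \<inter> l"])
  show "\<forall>P\<in>{P \<in> net_points. P \<subseteq> m}. m \<inter> line_thr j P = P"
  proof safe
    fix P assume P: "P \<in> net_points" "P \<subseteq> m"
    have "line_thr i P = m" using line_thr_unique[OF P(1) assms(1,4) P(2)] .
    with line_thr_inter[OF P(1) assms(1-3)] have "m \<inter> line_thr j P = P" by simp
    thus "x \<in> P" if "x \<in> m" "x \<in> line_thr j P" for x using that by auto
    show "x \<in> m" if "x \<in> P" for x using that P by auto
    show "x \<in> line_thr j P" if "x \<in> P" for x using that subset_line_thr[OF P(1) assms(2)] by auto
  qed
  show "\<forall>l\<in>lam j. line_thr j (m \<inter> l) = l"
    using assms by (simp add: line_thr_inter_right)
  show "line_thr j ` {P \<in> net_points. P \<subseteq> m} \<subseteq> lam j" using assms by (auto simp: line_thr_in_lam)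
  show "(\<lambda>l. m \<inter> l) ` lam j \<subseteq> {P \<in> net_points. P \<subseteq> m}" using assms inter_in_net_points by auto
qed

section \<open>Proportionality factors of linear forms along a line\<close>

definition ratio :: "nat \<Rightarrow> nat \<Rightarrow> nat \<Rightarrow> ('a ^ 3) set \<Rightarrow> 'a" where
  "ratio i j r P = (SOME c. c \<noteq> 0 \<and>
     (\<forall>x\<in>line_thr r P. line_form (line_thr i P) x = c * line_form (line_thr j P) x))"

lemma
  assumes "P \<in> net_points" "i < k" "j < k" "r < k" "i \<noteq> r" "j \<noteq> r"
  shows ratio_nonzero: "ratio i j r P \<noteq> 0"
    and line_form_ratio: "x \<in> line_thr r P \<Longrightarrow>
      line_form (line_thr i P) x = ratio i j r P * line_form (line_thr j P) x"
proof -
  obtain c where "c \<noteq> 0" "\<And>x. x \<in> line_thr r P \<Longrightarrow> line_form (line_thr i P) x = c * line_form (line_thr j P) x"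
    by (rule line_forms_proportional[OF line_thr_pg_line[OF assms(1,2)] line_thr_pg_line[OF assms(1,4)]
        line_thr_pg_line[OF assms(1,3)] net_points_pg_points[OF assms(1)] subset_line_thr[OF assms(1,2)]
        subset_line_thr[OF assms(1,4)] subset_line_thr[OF assms(1,3)] line_thr_distinct[OF assms(1,2,4,5)]
        line_thr_distinct[OF assms(1,3,4,6)]], rule that)
  hence "\<exists>c. c \<noteq> 0 \<and> (\<forall>x\<in>line_thr r P. line_form (line_thr i P) x = c * line_form (line_thr j P) x)"
    by (intro exI[of _ c] conjI ballI)
  from someI_ex[OF this, folded ratio_def]
  show "ratio i j r P \<noteq> 0" "x \<in> line_thr r P \<Longrightarrow>
      line_form (line_thr i P) x = ratio i j r P * line_form (line_thr j P) x" by auto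
qed

text \<open>The subset \<open>S\<close> is left free for two uses: all net points of
  \<open>m\<close> in \<open>prod_component\<close>, and all but one of them in
  \<open>ratio_eq_net_ratio\<close>.\<close>

lemma prod_line_form:
  assumes "i < k" "j < k" "r < k" "i \<noteq> r" "j \<noteq> r" "m \<in> lam r" "x \<in> m"
    and S: "S \<subseteq> {P \<in> net_points. P \<subseteq> m}"
  shows "(\<Prod>h\<in>line_thr i ` S. line_form h x) =
    (\<Prod>P\<in>S. ratio i j r P) * (\<Prod>h\<in>line_thr j ` S. line_form h x)"
proof -
  have *: "inj_on (line_thr t) S" if "t < k" "t \<noteq> r" for t
    using inj_on_subset[OF bij_betw_imp_inj_on[OF bij_betw_line_thr[OF assms(3) that(1) _ assms(6)]] S]
      that(2) by simp
  have "line_form (line_thr i P) x = ratio i j r P * line_form (line_thr j P) x" if "P \<in> S" for P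
  proof -
    have P: "P \<in> net_points" "P \<subseteq> m" using that S by auto
    have "line_thr r P = m" using line_thr_unique[OF P(1) assms(3,6) P(2)] .
    thus ?thesis using line_form_ratio[OF P(1) assms(1-5)] assms(7) by simp
  qed
  thus ?thesis using *[OF assms(1,4)] *[OF assms(2,5)] by (simp add: prod.reindex prod.distrib)
qed

definition net_ratio :: "nat \<Rightarrow> nat \<Rightarrow> nat \<Rightarrow> ('a ^ 3) set \<Rightarrow> 'a" where
  "net_ratio i j r m = (\<Prod>P\<in>{P \<in> net_points. P \<subseteq> m}. ratio i j r P)"

lemma prod_component:
  assumes "i < k" "j < k" "r < k" "i \<noteq> r" "j \<noteq> r" "m \<in> lam r" "x \<in> m"
  shows "(\<Prod>h\<in>lam i. line_form h x) = net_ratio i j r m * (\<Prod>h\<in>lam j. line_form h x)"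
proof -
  have "line_thr t ` {P \<in> net_points. P \<subseteq> m} = lam t" if "t < k" "t \<noteq> r" for t
    using bij_betw_imp_surj_on[OF bij_betw_line_thr[OF assms(3) that(1) _ assms(6)]] that(2) by simp
  thus ?thesis using prod_line_form[OF assms order_refl] assms by (simp add: net_ratio_def)
qed

text \<open>Evaluate \<open>prod_component\<close> at a common vector \<open>p\<close> of both lines
  and cancel. The cancelled product is nonzero: a line of component \<open>j\<close> through
  \<open>p\<close> would produce a net point on two lines of component \<open>r\<close>.\<close>

lemma net_ratio_eq:
  assumes "i < k" "j < k" "r < k" "i \<noteq> r" "j \<noteq> r" "m \<in> lam r" "m' \<in> lam r"
  shows "net_ratio i j r m = net_ratio i j r m'"
proof (cases "m = m'")
  case False
  obtain p where p: "p \<in> m" "p \<in> m'" "p \<noteq> 0"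
    by (rule pg_lines_meet[OF lam_lines[OF assms(3,6)] lam_lines[OF assms(3,7)]], rule that)
  have "line_form h p \<noteq> 0" if h: "h \<in> lam j" for h
  proof
    assume "line_form h p = 0"
    hence "p \<in> h" using line_form_eq_0_iff[OF lam_lines[OF assms(2) h]] by simp
    have pt: "m \<inter> h \<in> net_points" using inter_in_net_points[of r j m h] h assms by simp
    have "m \<inter> h \<subseteq> m'"
      using pg_point_subset_line_iff[OF net_points_pg_points[OF pt] _ p(3) lam_lines[OF assms(3,7)]]
        p \<open>p \<in> h\<close> by simp
    hence "m = m'" using line_thr_unique[OF pt assms(3,6)] line_thr_unique[OF pt assms(3,7)] by simp
    thus False using False by simp
  qed
  hence "(\<Prod>h\<in>lam j. line_form h p) \<noteq> 0" using finite_lam assms by simp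
  moreover have "net_ratio i j r m * (\<Prod>h\<in>lam j. line_form h p)
      = net_ratio i j r m' * (\<Prod>h\<in>lam j. line_form h p)"
    using prod_component[OF assms(1-6) p(1)] prod_component[OF assms(1-5,7) p(2)] by (rule subst)
  ultimately show ?thesis by simp
qed simp

text \<open>
  The gradient at \<open>P\<close> of the product of the forms of component \<open>i\<close> is \<open>cofactor i P p\<close>
  times the form of the line of component \<open>i\<close> through \<open>P\<close>.
\<close>

definition cofactor :: "nat \<Rightarrow> ('a ^ 3) set \<Rightarrow> 'a ^ 3 \<Rightarrow> 'a" where
  "cofactor i P p = (\<Prod>h\<in>lam i - {line_thr i P}. line_form h p)"

lemma cofactor_nonzero:
  assumes "P \<in> net_points" "i < k" "p \<in> P" "p \<noteq> 0"
  shows "cofactor i P p \<noteq> 0"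
proof -
  have "line_form h p \<noteq> 0" if "h \<in> lam i - {line_thr i P}" for h
  proof -
    have h: "h \<in> lam i" "h \<noteq> line_thr i P" using that by auto
    note line = lam_lines[OF assms(2) h(1)]
    have "\<not> P \<subseteq> h" using h line_thr_unique[OF assms(1,2) h(1)] by auto
    hence "p \<notin> h"
      using pg_point_subset_line_iff[OF net_points_pg_points[OF assms(1)] assms(3,4) line] by simp
    thus ?thesis using line_form_eq_0_iff[OF line] by simp
  qed
  thus ?thesis unfolding cofactor_def using finite_lam assms by simp
qed

text \<open>At \<open>p\<close> the products over whole components vanish, so the factors belonging
  to \<open>P\<close> are split off first and only the remaining ones are compared at
  \<open>p\<close>.\<close>

lemma ratio_eq_net_ratio:
  assumes "i < k" "j < k" "r < k" "i \<noteq> r" "j \<noteq> r" "P \<in> net_points" "p \<in> P" "p \<noteq> 0"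
  shows "cofactor i P p * ratio i j r P = net_ratio i j r (line_thr r P) * cofactor j P p"
proof -
  let ?m = "line_thr r P"
  let ?S = "{Q \<in> net_points. Q \<subseteq> ?m}"
  have m: "?m \<in> lam r" "P \<in> ?S" "p \<in> ?m"
    using assms(7) line_thr_in_lam[OF assms(6,3)] subset_line_thr[OF assms(6,3)] assms(6) by auto
  have im: "line_thr t ` (?S - {P}) = lam t - {line_thr t P}" if "t < k" "t \<noteq> r" for t
  proof -
    have b: "bij_betw (line_thr t) ?S (lam t)" using bij_betw_line_thr[OF assms(3) that(1) _ m(1)] that(2) by simp
    have "line_thr t ` (?S - {P}) = line_thr t ` ?S - line_thr t ` {P}"
      by (rule inj_on_image_set_diff[OF bij_betw_imp_inj_on[OF b]]) (use m(2) in auto)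
    thus ?thesis by (simp only: bij_betw_imp_surj_on[OF b] image_insert image_empty)
  qed
  have "finite ?S" using finite_net_points[of i r] assms by simp
  hence "net_ratio i j r ?m = ratio i j r P * (\<Prod>Q\<in>?S - {P}. ratio i j r Q)"
    unfolding net_ratio_def using m(2) by (rule prod.remove)
  moreover have "cofactor i P p = (\<Prod>Q\<in>?S - {P}. ratio i j r Q) * cofactor j P p"
    using prod_line_form[OF assms(1-5) m(1,3), of "?S - {P}"] im[OF assms(1,4)] im[OF assms(2,5)]
    by (simp add: cofactor_def)
  ultimately show ?thesis by (simp add: mult_ac)
qed

text \<open>Cross-ratio of the lines of components \<open>i, j, a, b\<close> through \<open>P\<close>.\<close>

definition cross :: "nat \<Rightarrow> nat \<Rightarrow> nat \<Rightarrow> nat \<Rightarrow> ('a ^ 3) set \<Rightarrow> 'a" where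
  "cross i j a b P = ratio i j b P / ratio i j a P"

section \<open>Relations between cross-ratios\<close>

lemma cross_nonzero:
  assumes "i < k" "j < k" "a < k" "b < k" "i \<noteq> a" "j \<noteq> a" "i \<noteq> b" "j \<noteq> b" "P \<in> net_points"
  shows "cross i j a b P \<noteq> 0"
  using assms by (simp add: cross_def ratio_nonzero)

text \<open>
  Both \<open>cross\<close> and the products of \<open>ratio\<close> along the lines of a fixed component are constant, so
  \<open>\<kappa>\<close> is the quotient of the two products. Multiplying \<open>\<kappa>\<close> over all \<open>n\<^sup>2\<close> points, grouped along
  the \<open>n\<close> lines of a component, gives \<open>\<kappa> ^ n\<^sup>2 = \<kappa> ^ n\<close>.
\<close>

lemma cross_power:
  assumes "i < k" "j < k" "a < k" "b < k" "i \<noteq> a" "j \<noteq> a" "i \<noteq> b" "j \<noteq> b" "P \<in> net_points"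
  shows "cross i j a b P ^ (n\<^sup>2 - n) = 1"
proof -
  define \<rho>a where "\<rho>a = net_ratio i j a (line_thr a P)"
  define \<rho>b where "\<rho>b = net_ratio i j b (line_thr b P)"
  have \<rho>: "net_ratio i j a m = \<rho>a" if "m \<in> lam a" for m
    using net_ratio_eq[OF assms(1,2,3,5,6) that line_thr_in_lam[OF assms(9,3)]] by (simp add: \<rho>a_def)
  have \<rho>': "net_ratio i j b m = \<rho>b" if "m \<in> lam b" for m
    using net_ratio_eq[OF assms(1,2,4,7,8) that line_thr_in_lam[OF assms(9,4)]] by (simp add: \<rho>b_def)
  have prod: "(\<Prod>Q\<in>net_points. ratio i j r Q) = \<sigma> ^ n"
    if r: "r < k" "i \<noteq> r" "j \<noteq> r" "\<And>m. m \<in> lam r \<Longrightarrow> net_ratio i j r m = \<sigma>" for r \<sigma>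
  proof -
    have "(\<Prod>Q\<in>net_points. ratio i j r Q) = (\<Prod>m\<in>lam r. \<Prod>Q\<in>{Q \<in> net_points. line_thr r Q = m}. ratio i j r Q)"
      using finite_net_points[OF assms(1) r(1,2)] finite_lam[OF r(1)] line_thr_in_lam[OF _ r(1)]
      by (intro prod.group[symmetric]) auto
    also have "\<dots> = (\<Prod>m\<in>lam r. net_ratio i j r m)"
      unfolding net_ratio_def
    proof (rule prod.cong[OF refl])
      fix m assume "m \<in> lam r"
      hence "{Q \<in> net_points. line_thr r Q = m} = {Q \<in> net_points. Q \<subseteq> m}"
        using line_thr_unique[OF _ r(1)] subset_line_thr[OF _ r(1)] by auto
      thus "(\<Prod>Q\<in>{Q \<in> net_points. line_thr r Q = m}. ratio i j r Q) = (\<Prod>Q\<in>{Q \<in> net_points. Q \<subseteq> m}. ratio i j r Q)"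
        by simp
    qed
    finally show ?thesis using r(4) card_lam[OF r(1)] by simp
  qed
  \<comment> \<open>The factor \<open>?s\<close> does not depend on \<open>r\<close>, so it cancels
    between the ratios for \<open>b\<close> and \<open>a\<close>.\<close>
  have const: "cross i j a b Q = \<rho>b / \<rho>a" if Q: "Q \<in> net_points" for Q
  proof -
    obtain q where q: "q \<in> Q" "q \<noteq> 0" using pg_point_nonzero[OF net_points_pg_points[OF Q]] .
    let ?s = "cofactor j Q q / cofactor i Q q"
    have nz: "cofactor i Q q \<noteq> 0" "cofactor j Q q \<noteq> 0"
      using cofactor_nonzero[OF Q _ q] assms(1,2) by auto
    have "ratio i j r Q = \<sigma> * ?s"
      if r: "r < k" "i \<noteq> r" "j \<noteq> r" "\<And>m. m \<in> lam r \<Longrightarrow> net_ratio i j r m = \<sigma>" for r \<sigma>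
      using ratio_eq_net_ratio[OF assms(1,2) r(1-3) Q q] nz r(4)[OF line_thr_in_lam[OF Q r(1)]]
      by (simp add: field_simps)
    from this[OF assms(3,5,6) \<rho>] this[OF assms(4,7,8) \<rho>']
    have "ratio i j a Q = \<rho>a * ?s" "ratio i j b Q = \<rho>b * ?s" by auto
    thus ?thesis using nz by (simp add: cross_def)
  qed
  define \<kappa> where "\<kappa> = \<rho>b / \<rho>a"
  have "\<kappa> ^ (n * n) = (\<Prod>Q\<in>net_points. cross i j a b Q)"
    using const card_net_points[OF assms(1,3,5)] by (simp add: \<kappa>_def)
  also have "\<dots> = \<kappa> ^ n"
    using prod[OF assms(3,5,6) \<rho>] prod[OF assms(4,7,8) \<rho>']
    by (simp add: cross_def prod_dividef \<kappa>_def power_divide)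
  finally have "\<kappa> ^ (n * n) = \<kappa> ^ n" .
  moreover have "n * n = n + (n\<^sup>2 - n)" by (simp add: power2_eq_square)
  ultimately have "\<kappa> ^ n * \<kappa> ^ (n\<^sup>2 - n) = \<kappa> ^ n * 1" by (metis power_add mult.right_neutral)
  moreover have "\<kappa> \<noteq> 0" using const[OF assms(9)] cross_nonzero[OF assms] by (simp add: \<kappa>_def)
  ultimately show ?thesis using const[OF assms(9)] by (simp add: \<kappa>_def)
qed

lemma cross_mult:
  assumes "i < k" "j < k" "b < k" "i \<noteq> b" "j \<noteq> b" "P \<in> net_points"
  shows "cross i j a b P * cross i j b c P = cross i j a c P"
  using assms by (simp add: cross_def ratio_nonzero)

text \<open>Vectors on the lines of components \<open>j\<close>, \<open>a\<close>, \<open>b\<close>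
  are linearly dependent modulo \<open>P\<close>. Applying the form of the line of component
  \<open>i\<close> to such a relation and dividing by its value at \<open>e a\<close> gives the
  identity.\<close>

lemma cross_add:
  assumes "i < k" "j < k" "a < k" "b < k" "distinct [i, j, a, b]" "P \<in> net_points"
  shows "cross i j a b P + cross i b a j P = 1"
proof -
  let ?f = "\<lambda>t. line_form (line_thr t P)"
  have "\<exists>e. e \<in> line_thr t P \<and> e \<notin> P" if "t < k" for t
  proof -
    have "line_thr t P \<noteq> P" using line_thr_pg_line[OF assms(6) that] net_points_pg_points[OF assms(6)]
      by (auto simp: pg_lines_def pg_points_def)
    thus ?thesis using subset_line_thr[OF assms(6) that] by auto
  qed
  then obtain e where e: "\<And>t. t < k \<Longrightarrow> e t \<in> line_thr t P" "\<And>t. t < k \<Longrightarrow> e t \<notin> P" by metis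
  have nz: "?f t (e s) \<noteq> 0" if "t < k" "s < k" "t \<noteq> s" for s t
    using e[of s] that line_thr_inter[OF assms(6), of t s] line_thr_pg_line[OF assms(6)]
    by (auto simp: line_form_eq_0_iff)
  have z: "?f t (e t) = 0" if "t < k" for t
    using e[of t] that line_thr_pg_line[OF assms(6)] by (auto simp: line_form_eq_0_iff)
  have ratio: "ratio s t r P = ?f s (e r) / ?f t (e r)"
    if "s < k" "t < k" "r < k" "s \<noteq> r" "t \<noteq> r" for r s t
    using line_form_ratio[of P s t r "e r"] that assms(6) e(1) nz by simp
  \<comment> \<open>The coefficients are chosen so that the forms of components \<open>j\<close> and
    \<open>b\<close> both kill \<open>?d\<close>, which puts \<open>?d\<close> in
    \<open>P\<close>.\<close>
  let ?s = "?f j (e a) / ?f j (e b)" and ?t = "?f b (e a) / ?f b (e j)"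
  let ?d = "e a - ?s *s e b - ?t *s e j"
  have expand: "?f u ?d = ?f u (e a) - ?s * ?f u (e b) - ?t * ?f u (e j)" if "u < k" for u
    using line_thr_pg_line[OF assms(6) that] by (simp add: line_form_diff line_form_scale)
  have "?f j ?d = 0" "?f b ?d = 0" using assms nz z by (auto simp: expand)
  hence "?d \<in> line_thr j P \<inter> line_thr b P" using line_thr_pg_line[OF assms(6)] assms
    by (auto simp: line_form_eq_0_iff)
  hence "?d \<in> P" using line_thr_inter[of P j b] assms by auto
  hence "?d \<in> line_thr i P" using subset_line_thr[of P i] assms by auto
  hence "?f i ?d = 0" using line_thr_pg_line[OF assms(6,1)] by (simp add: line_form_eq_0_iff)
  hence "?f i (e a) - (?s * ?f i (e b) + ?t * ?f i (e j)) = 0"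
    unfolding expand[OF assms(1)] by (simp only: diff_diff_eq)
  hence "?f i (e a) = ?s * ?f i (e b) + ?t * ?f i (e j)" by (simp only: right_minus_eq)
  moreover have "?f i (e a) \<noteq> 0" "?f j (e a) \<noteq> 0" "?f j (e b) \<noteq> 0" "?f b (e a) \<noteq> 0" "?f b (e j) \<noteq> 0"
    using nz assms by auto
  moreover have "cross i j a b P = ?s * ?f i (e b) / ?f i (e a)"
      "cross i b a j P = ?t * ?f i (e j) / ?f i (e a)"
    using assms by (simp_all add: cross_def ratio)
  ultimately show ?thesis by (metis add_divide_distrib divide_self)
qed

lemma net_points_nonempty:
  assumes "k \<ge> 2"
  shows "net_points \<noteq> {}"
  using card_net_points[of 0 1] assms n_pos by auto

end

section \<open>Integer norms\<close>

text \<open>Pseudo-division scales the dividend by a power of the leading coefficient, here 1, so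
  division with remainder stays over the integers.\<close>

lemma monic_division:
  fixes f h :: "int poly"
  assumes "lead_coeff f = 1"
  obtains q r where "h = f * q + r" "r = 0 \<or> degree r < degree f"
proof -
  obtain q r where qr: "pseudo_divmod h f = (q, r)" by force
  have f0: "f \<noteq> 0" using assms by auto
  show ?thesis using that[of q r] pseudo_divmod[OF f0 qr] assms by simp
qed

text \<open>The alternative \<open>p = 0\<close> covers \<open>m = 0\<close>, where no degree is
  small enough.\<close>

lemma poly_eq_sum_lessThan:
  fixes p :: "'a::comm_ring_1 poly"
  assumes "degree p < m \<or> p = 0"
  shows "poly p x = (\<Sum>i<m. poly.coeff p i * x ^ i)"
proof (cases "p = 0")
  case False
  hence "{..degree p} \<subseteq> {..<m}" using assms by auto
  hence "(\<Sum>i\<le>degree p. poly.coeff p i * x ^ i) = (\<Sum>i<m. poly.coeff p i * x ^ i)"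
    by (intro sum.mono_neutral_left) (auto simp: coeff_eq_0)
  thus ?thesis by (simp add: poly_altdef)
qed simp

lemma monic_eq_prod_roots:
  fixes p :: "'a::field poly"
  assumes "lead_coeff p = 1" "finite S" "card S = degree p" "\<And>z. z \<in> S \<Longrightarrow> poly p z = 0"
  shows "p = (\<Prod>z\<in>S. [:-z, 1:])"
proof (rule poly_eqI_degree_lead_coeff[where n = "degree p" and A = S])
  have deg: "degree (\<Prod>z\<in>S. [:-z, 1:]) = degree p"
    using assms by (subst degree_prod_eq_sum_degree) auto
  have "lead_coeff (\<Prod>z\<in>S. [:-z, 1:]) = 1" by (simp add: lead_coeff_prod)
  thus "poly.coeff p (degree p) = poly.coeff (\<Prod>z\<in>S. [:-z, 1:]) (degree p)" using deg assms(1) by simp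
  show "degree (\<Prod>z\<in>S. [:-z, 1:]) \<le> degree p" using deg by simp
  show "poly p z = poly (\<Prod>z\<in>S. [:-z, 1:]) z" if "z \<in> S" for z
    using that assms by (simp add: poly_prod)
qed (use assms in auto)

text \<open>
  The norm of \<open>g\<close> is the determinant of multiplication by \<open>g\<close> on \<open>\<int>[x] / (f)\<close>. Evaluating at
  a root of \<open>f\<close> gives a left eigenvector, over any field.
\<close>

lemma integer_norm:
  fixes f g :: "int poly" and S :: "complex set"
  assumes monic: "lead_coeff f = 1" and S: "finite S"
    and f: "map_poly of_int f = (\<Prod>z\<in>S. [:-z, 1:])"
  shows "\<exists>M :: int. of_int M = (\<Prod>z\<in>S. poly (map_poly of_int g) z) \<and>
    (\<forall>w :: 'a::field. poly (map_poly of_int f) w = 0 \<longrightarrow> poly (map_poly of_int g) w = 0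
      \<longrightarrow> of_int M = (0 :: 'a))"
proof -
  define m where "m = degree f"
  have "degree (map_poly of_int f :: complex poly) = degree f" by simp
  moreover have "degree (\<Prod>z\<in>S. [:-z, 1:]) = card S"
    by (subst degree_prod_eq_sum_degree) auto
  ultimately have m: "card S = m" using f by (simp add: m_def)
  have "\<forall>r. \<exists>q t. Polynomial.monom 1 r * g = f * q + t \<and> (t = 0 \<or> degree t < m)"
    using monic_division[OF monic] unfolding m_def by metis
  then obtain q t where qt: "\<And>r. Polynomial.monom 1 r * g = f * q r + t r" "\<And>r. t r = 0 \<or> degree (t r) < m"
    by metis
  \<comment> \<open>Column \<open>r\<close> holds the remainder of \<open>x ^ r * g\<close> modulo
    \<open>f\<close>.\<close>
  define B where "B = mat m m (\<lambda>(s, r). poly.coeff (t r) s)"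
  have B: "B \<in> carrier_mat m m" by (simp add: B_def)
  \<comment> \<open>The eigenvector equation, entry by entry. The field \<open>'b\<close> is
    arbitrary because both the complex numbers and \<open>'a\<close> are needed.\<close>
  have eval: "(\<Sum>s<m. w ^ s * of_int (poly.coeff (t r) s)) = w ^ r * poly (map_poly of_int g) w"
    if w: "poly (map_poly of_int f) w = 0" for w :: "'b::field" and r
  proof -
    have "degree (map_poly of_int (t r) :: 'b poly) < m \<or> (map_poly of_int (t r) :: 'b poly) = 0"
      using qt(2)[of r] degree_map_poly_le[of "of_int :: int \<Rightarrow> 'b" "t r"] by auto
    hence "(\<Sum>s<m. w ^ s * of_int (poly.coeff (t r) s)) = poly (map_poly of_int (t r)) w"
      by (subst poly_eq_sum_lessThan) (simp_all add: mult.commute)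
    also have "\<dots> = poly (map_poly of_int (f * q r + t r)) w"
      using w by (simp add: of_int_poly_hom.hom_add of_int_poly_hom.hom_mult)
    also have "\<dots> = w ^ r * poly (map_poly of_int g) w"
      by (simp only: qt(1)[symmetric] of_int_poly_hom.hom_mult poly_mult) (simp add: poly_monom)
    finally show ?thesis .
  qed
  obtain z where z: "bij_betw z {..<m} S" using ex_bij_betw_nat_finite[OF S] m
    by (auto simp: lessThan_atLeast0)
  \<comment> \<open>\<open>W\<close> is the Vandermonde matrix of the roots. Its rows are left
    eigenvectors of \<open>B\<close>, so it diagonalises \<open>B\<close> once it is known to be
    invertible.\<close>
  define W where "W = mat m m (\<lambda>(k, s). z k ^ s)"
  define D where "D = mat m m (\<lambda>(k, l). if k = l then poly (map_poly of_int g) (z k) else 0)"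
  let ?B = "map_mat of_int B :: complex mat"
  have carrier: "W \<in> carrier_mat m m" "D \<in> carrier_mat m m" "?B \<in> carrier_mat m m"
    using B by (auto simp: W_def D_def)
  have fz: "poly (map_poly of_int f) (z k) = 0" if "k < m" for k
    using that z S unfolding f by (auto simp: poly_prod bij_betw_def)
  have "W * ?B = D * W"
  proof (rule eq_matI)
    fix k r assume "k < dim_row (D * W)" "r < dim_col (D * W)"
    hence kr: "k < m" "r < m" using carrier by auto
    have "(W * ?B) $$ (k, r) = (\<Sum>s<m. z k ^ s * of_int (poly.coeff (t r) s))"
      using kr by (simp add: W_def B_def scalar_prod_def lessThan_atLeast0)
    also have "\<dots> = z k ^ r * poly (map_poly of_int g) (z k)"
      using fz kr by (intro eval) auto
    also have "\<dots> = (\<Sum>l<m. (if k = l then poly (map_poly of_int g) (z k) else 0) * z l ^ r)"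
      using kr by (simp add: if_distribR if_distrib[of "\<lambda>x. x * _"] sum.delta cong: if_cong)
    also have "\<dots> = (D * W) $$ (k, r)"
      using kr by (simp add: W_def D_def scalar_prod_def lessThan_atLeast0)
    finally show "(W * ?B) $$ (k, r) = (D * W) $$ (k, r)" .
  qed (use carrier in auto)
  hence "det (W * ?B) = det (D * W)" by (rule arg_cong)
  hence "det W * det ?B = det D * det W"
    unfolding det_mult[OF carrier(1,3)] det_mult[OF carrier(2,1)] .
  \<comment> \<open>A nonzero kernel vector would be the coefficient vector of a nonzero polynomial
    of degree below \<open>m\<close> with \<open>m\<close> roots.\<close>
  moreover have "det W \<noteq> 0"
  proof
    assume "det W = 0"
    then obtain v where v: "v \<in> carrier_vec m" "v \<noteq> 0\<^sub>v m" "W *\<^sub>v v = 0\<^sub>v m"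
      using det_0_iff_vec_prod_zero[OF carrier(1)] by auto
    define p where "p = (\<Sum>s<m. Polynomial.monom (v $ s) s)"
    have coeff: "poly.coeff p s = (if s < m then v $ s else 0)" for s
      unfolding p_def by (simp add: coeff_sum)
    have "p \<noteq> 0"
    proof
      assume "p = 0"
      hence "v $ s = 0" if "s < m" for s using coeff[of s] that by simp
      hence "v = 0\<^sub>v m" using v(1) by (intro eq_vecI) auto
      thus False using v(2) by simp
    qed
    have "m > 0" using v(1,2) by (cases m) auto
    have "poly p u = 0" if u: "u \<in> S" for u
    proof -
      obtain k where k: "k < m" "u = z k" using z u by (auto simp: bij_betw_def)
      have "poly p u = (\<Sum>s<m. z k ^ s * v $ s)"
        by (simp add: p_def poly_sum poly_monom k mult.commute)
      also have "\<dots> = (W *\<^sub>v v) $ k"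
        using k v(1) by (simp add: W_def scalar_prod_def lessThan_atLeast0)
      finally show ?thesis using v(3) k by simp
    qed
    hence "card S \<le> card {u. poly p u = 0}"
      using \<open>p \<noteq> 0\<close> by (intro card_mono poly_roots_finite) auto
    also have "\<dots> \<le> degree p" using \<open>p \<noteq> 0\<close> by (rule card_poly_roots_bound)
    also have "\<dots> < m" using \<open>m > 0\<close> by (intro degree_lessI) (auto simp: coeff)
    finally show False using m by simp
  qed
  ultimately have "det ?B = det D" by (metis mult.commute mult_left_cancel)
  moreover have "det ?B = of_int (det B)" by (rule of_int_hom.hom_det)
  moreover have "det D = (\<Prod>k<m. poly (map_poly of_int g) (z k))"
    by (subst det_upper_triangular[of _ m])
      (auto simp: D_def diag_mat_def prod.distinct_set_conv_list[symmetric] lessThan_atLeast0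
        intro!: prod.cong)
  moreover have "\<dots> = (\<Prod>z\<in>S. poly (map_poly of_int g) z)"
    using prod.reindex_bij_betw[OF z] .
  ultimately have M: "of_int (det B) = (\<Prod>z\<in>S. poly (map_poly of_int g) z)" by simp
  \<comment> \<open>Here the eigenvalue is 0, so the powers of \<open>w\<close> form a kernel vector
    of the transpose. It is nonzero because \<open>m > 0\<close> and its first entry is 1.\<close>
  have "of_int (det B) = (0 :: 'a)"
    if w: "poly (map_poly of_int f) w = 0" "poly (map_poly of_int g) w = 0" for w :: 'a
  proof -
    let ?A = "transpose_mat (map_mat of_int B :: 'a mat)"
    let ?v = "Matrix.vec m (\<lambda>s. w ^ s)"
    have A: "?A \<in> carrier_mat m m" using B by auto
    have "m > 0"
    proof (rule ccontr)
      assume "\<not> m > 0"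
      hence "f = 1" using monic by (auto simp: m_def elim!: degree_eq_zeroE)
      thus False using w(1) by simp
    qed
    hence "?v \<noteq> 0\<^sub>v m" by (metis index_vec index_zero_vec(1) power_0 zero_neq_one)
    moreover have "?A *\<^sub>v ?v = 0\<^sub>v m"
    proof (rule eq_vecI)
      fix r assume "r < dim_vec (0\<^sub>v m :: 'a Matrix.vec)"
      hence r: "r < m" by simp
      have "(?A *\<^sub>v ?v) $ r = (\<Sum>s<m. w ^ s * of_int (poly.coeff (t r) s))"
        using r by (simp add: B_def scalar_prod_def lessThan_atLeast0 mult.commute)
      thus "(?A *\<^sub>v ?v) $ r = 0\<^sub>v m $ r" using eval[OF w(1)] w(2) r by simp
    qed (use B in auto)
    moreover have "?v \<in> carrier_vec m" by simp
    ultimately have "det ?A = 0" unfolding det_0_iff_vec_prod_zero[OF A] by blast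
    moreover have "det ?A = det (map_mat of_int B :: 'a mat)"
      by (rule det_transpose) (use B in auto)
    moreover have "\<dots> = of_int (det B)" by (rule of_int_hom.hom_det)
    ultimately show ?thesis by simp
  qed
  with M show ?thesis by blast
qed

section \<open>Cyclotomic polynomials over the integers\<close>

text \<open>For \<open>d > 0\<close> this says that \<open>z\<close> has multiplicative order
  \<open>d\<close>. For \<open>d = 0\<close> it holds for every \<open>z\<close>, hence the
  positivity hypotheses below.\<close>

definition prim_root :: "nat \<Rightarrow> 'a::field \<Rightarrow> bool" where
  "prim_root d z \<longleftrightarrow> z ^ d = 1 \<and> (\<forall>e. 0 < e \<and> e < d \<longrightarrow> z ^ e \<noteq> 1)"

lemma prim_root_power_eq_1_iff:
  assumes "prim_root d z" "d > 0"
  shows "z ^ e = 1 \<longleftrightarrow> d dvd e"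
proof -
  have "z ^ e = z ^ (d * (e div d) + e mod d)" by simp
  also have "\<dots> = z ^ (e mod d)"
    using assms(1) by (simp only: power_add power_mult prim_root_def power_one mult_1)
  finally have "z ^ e = z ^ (e mod d)" .
  moreover have "e mod d < d" using assms(2) by simp
  ultimately show ?thesis using assms(1) by (auto simp: prim_root_def dvd_eq_mod_eq_0)
qed

lemma ex_prim_root_dvd:
  assumes "z ^ h = 1" "h > 0"
  obtains d where "d > 0" "d dvd h" "prim_root d z"
proof -
  define d where "d = (LEAST d. d > 0 \<and> z ^ d = 1)"
  have d: "d > 0 \<and> z ^ d = 1"
    unfolding d_def by (rule LeastI[of _ h]) (use assms in simp)
  have "z ^ e \<noteq> 1" if "0 < e" "e < d" for e
    using not_less_Least[of e "\<lambda>d. d > 0 \<and> z ^ d = 1"] that unfolding d_def[symmetric] by simp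
  hence p: "prim_root d z" using d by (simp add: prim_root_def)
  show ?thesis using that[of d] d p prim_root_power_eq_1_iff[OF p, of h] assms(1) by simp
qed

lemma prim_root_unique:
  assumes "prim_root d z" "prim_root e z" "d > 0" "e > 0"
  shows "d = e"
  using assms prim_root_power_eq_1_iff[of d z e] prim_root_power_eq_1_iff[of e z d]
  by (intro dvd_antisym) (auto simp: prim_root_def)

lemma degree_monom_minus_one:
  assumes "h > 0"
  shows "degree (Polynomial.monom 1 h - 1 :: 'a::comm_ring_1 poly) = h"
proof (rule antisym)
  show "degree (Polynomial.monom 1 h - 1 :: 'a poly) \<le> h"
    by (intro degree_diff_le degree_monom_le) simp
  show "h \<le> degree (Polynomial.monom 1 h - 1 :: 'a poly)"
    using assms by (intro le_degree) simp
qed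

lemma finite_card_unity_roots:
  assumes "h > 0"
  shows "finite {z :: 'a::field. z ^ h = 1}" "card {z :: 'a. z ^ h = 1} \<le> h"
proof -
  let ?p = "Polynomial.monom 1 h - 1 :: 'a poly"
  have p: "?p \<noteq> 0" using degree_monom_minus_one[OF assms, where ?'a = 'a] assms by auto
  have eq: "{z. z ^ h = 1} = {z. poly ?p z = 0}" by (simp add: poly_monom)
  show "finite {z :: 'a. z ^ h = 1}" unfolding eq using p by (rule poly_roots_finite)
  show "card {z :: 'a. z ^ h = 1} \<le> h"
    unfolding eq using card_poly_roots_bound[OF p] degree_monom_minus_one[OF assms, where ?'a = 'a]
    by simp
qed

text \<open>The \<open>h\<close> listed powers are pairwise distinct, and a field has at most
  \<open>h\<close> solutions.\<close>

lemma unity_roots_eq_powers: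
  assumes "prim_root h w" "h > 0"
  shows "{z :: 'a::field. z ^ h = 1} = (\<lambda>k. w ^ k) ` {..<h}"
proof (rule sym, rule card_subset_eq)
  show "finite {z :: 'a. z ^ h = 1}" using assms by (intro finite_card_unity_roots)
  have wh: "w ^ h = 1" using assms by (simp add: prim_root_def)
  show sub: "(\<lambda>k. w ^ k) ` {..<h} \<subseteq> {z. z ^ h = 1}"
    by (auto simp: power_mult[symmetric] mult.commute[of _ h]) (simp add: power_mult wh)
  have w0: "w \<noteq> 0" using wh assms(2) by (auto simp: power_0_left)
  have "i = j" if "i < h" "j < h" "w ^ i = w ^ j" "i \<le> j" for i j
  proof -
    have "w ^ i * w ^ (j - i) = w ^ i * 1" using that(3,4) by (metis le_add_diff_inverse mult.right_neutral power_add)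
    hence "w ^ (j - i) = 1" using w0 by simp
    hence "h dvd j - i" using prim_root_power_eq_1_iff[OF assms] by blast
    thus ?thesis using that by (auto dest: dvd_imp_le)
  qed
  hence "inj_on (\<lambda>k. w ^ k) {..<h}" by (intro inj_onI) (metis lessThan_iff nat_le_linear)
  hence "card ((\<lambda>k. w ^ k) ` {..<h}) = h" by (simp add: card_image)
  moreover have "card ((\<lambda>k. w ^ k) ` {..<h}) \<le> card {z :: 'a. z ^ h = 1}"
    using sub assms by (intro card_mono finite_card_unity_roots) auto
  ultimately show "card ((\<lambda>k. w ^ k) ` {..<h}) = card {z :: 'a. z ^ h = 1}"
    using finite_card_unity_roots(2)[OF assms(2), where ?'a = 'a] by simp
qed

lemma ex_prim_root_complex:
  assumes "h > 0"
  obtains z :: complex where "prim_root h z"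
proof
  let ?z = "cis (2 * pi / real h)"
  have pow: "?z ^ k = cis (2 * pi * real k / real h)" for k
    by (simp add: Complex.DeMoivre mult_ac)
  have inj: "inj_on (\<lambda>k. cis (2 * pi * real k / real h)) {..<h}"
    using Complex.bij_betw_roots_unity[OF assms] by (rule bij_betw_imp_inj_on)
  have "?z ^ e \<noteq> 1" if "0 < e" "e < h" for e
  proof
    assume "?z ^ e = 1"
    hence "e = 0" using inj_onD[OF inj, of e 0] that pow by simp
    thus False using that by simp
  qed
  moreover have "?z ^ h = 1" using assms by (simp add: pow)
  ultimately show "prim_root h ?z" by (simp add: prim_root_def)
qed

text \<open>If \<open>z = w ^ l\<close> and \<open>g = gcd l h\<close>, then already
  \<open>z ^ (h div g) = 1\<close>, which forces \<open>g = 1\<close>. The upper bound suffices for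
  estimating the norm.\<close>

lemma card_prim_roots:
  assumes "h > 0"
  shows "finite {z :: complex. prim_root h z}" "card {z :: complex. prim_root h z} \<le> totient h"
proof -
  obtain w :: complex where w: "prim_root h w" using ex_prim_root_complex[OF assms] .
  have "{z. prim_root h z} \<subseteq> (\<lambda>k. w ^ k) ` totatives h"
  proof
    fix z :: complex assume "z \<in> {z. prim_root h z}"
    hence z: "prim_root h z" by simp
    hence "z \<in> (\<lambda>k. w ^ k) ` {..<h}"
      using unity_roots_eq_powers[OF w assms] by (auto simp: prim_root_def)
    then obtain k where k: "k < h" "z = w ^ k" by auto
    \<comment> \<open>\<open>totatives h\<close> lies in \<open>{0<..h}\<close>, so exponent 0 is
      replaced by \<open>h\<close>.\<close>
    define l where "l = (if k = 0 then h else k)"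
    have l: "0 < l" "l \<le> h" "z = w ^ l" using k w assms by (auto simp: l_def prim_root_def)
    define g where "g = gcd l h"
    obtain l' h' where lh: "l = g * l'" "h = g * h'" unfolding g_def by (meson dvd_def gcd_dvd1 gcd_dvd2)
    have "z ^ h' = (w ^ h) ^ l'"
      by (simp only: l(3) power_mult[symmetric]) (simp add: lh mult_ac)
    also have "\<dots> = 1" using w by (simp add: prim_root_def)
    finally have "h dvd h'" using prim_root_power_eq_1_iff[OF z assms] by blast
    moreover have "h' > 0" using lh assms by (cases h') auto
    ultimately have "g * h' \<le> 1 * h'" using lh(2) by (auto dest: dvd_imp_le)
    hence "g \<le> 1" using \<open>h' > 0\<close> by simp
    moreover have "g > 0" using assms by (simp add: g_def)
    ultimately have "g = 1" by linarith
    hence "coprime l h" unfolding g_def coprime_iff_gcd_eq_1 .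
    hence "l \<in> totatives h" using l by (auto simp: totatives_def)
    thus "z \<in> (\<lambda>k. w ^ k) ` totatives h" using l(3) by blast
  qed
  thus "finite {z :: complex. prim_root h z}" "card {z :: complex. prim_root h z} \<le> totient h"
    by (auto intro: finite_subset surj_card_le simp: totient_def)
qed

section \<open>Factorisation of \<open>x ^ h - 1\<close> into cyclotomic polynomials\<close>

lemma prod_prim_roots:
  assumes "h > 0"
  shows "(\<Prod>d | d dvd h. \<Prod>z | prim_root d z. [:-z, 1:]) = (Polynomial.monom 1 h - 1 :: complex poly)"
proof -
  let ?p = "Polynomial.monom 1 h - 1 :: complex poly"
  have "lead_coeff ?p = 1"
    unfolding degree_monom_minus_one[OF assms] using assms by simp
  moreover have "card {z :: complex. z ^ h = 1} = degree ?p"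
    using card_roots_unity_eq[OF assms] degree_monom_minus_one[OF assms, where ?'a = complex] by simp
  ultimately have "?p = (\<Prod>z | z ^ h = 1. [:-z, 1:])"
    using finite_card_unity_roots(1)[OF assms] by (intro monic_eq_prod_roots) (auto simp: poly_monom)
  \<comment> \<open>The roots are grouped by their exact order.\<close>
  also have "{z :: complex. z ^ h = 1} = (\<Union>d \<in> {d. d dvd h}. {z. prim_root d z})"
  proof (intro equalityI subsetI)
    fix z :: complex assume "z \<in> {z. z ^ h = 1}"
    thus "z \<in> (\<Union>d \<in> {d. d dvd h}. {z. prim_root d z})"
      using ex_prim_root_dvd[of z h] assms by auto
  next
    fix z :: complex assume "z \<in> (\<Union>d \<in> {d. d dvd h}. {z. prim_root d z})"
    then obtain d where d: "d dvd h" "prim_root d z" by auto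
    moreover have "d > 0" using dvd_pos_nat[OF assms d(1)] .
    ultimately show "z \<in> {z. z ^ h = 1}" using prim_root_power_eq_1_iff by auto
  qed
  also have "(\<Prod>z \<in> \<dots>. [:-z, 1:]) = (\<Prod>d | d dvd h. \<Prod>z | prim_root d z. [:-z, 1:])"
  proof (rule prod.UNION_disjoint)
    show "finite {d. d dvd h}" using assms by simp
    have pos: "d > 0" if "d dvd h" for d using dvd_pos_nat[OF assms that] .
    show "\<forall>d\<in>{d. d dvd h}. finite {z :: complex. prim_root d z}"
      using pos card_prim_roots(1) by auto
    show "\<forall>d\<in>{d. d dvd h}. \<forall>e\<in>{d. d dvd h}. d \<noteq> e \<longrightarrow>
        {z :: complex. prim_root d z} \<inter> {z. prim_root e z} = {}"
      using pos prim_root_unique by blast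
  qed
  finally show ?thesis by simp
qed

text \<open>By induction the product \<open>Q\<close> over the proper divisors is integral and
  monic. Dividing \<open>x ^ h - 1\<close> by it over the integers must give the complex
  quotient.\<close>

lemma ex_cyclotomic:
  assumes "h > 0"
  shows "\<exists>f :: int poly. map_poly of_int f = (\<Prod>z | prim_root h z. [:-z, 1 :: complex:])"
  using assms
proof (induction h rule: less_induct)
  case (less h)
  let ?P = "\<lambda>d. \<Prod>z | prim_root d z. [:-z, 1 :: complex:]"
  let ?I = "{d. d dvd h} - {h}"
  have "\<forall>d\<in>?I. \<exists>f :: int poly. map_poly of_int f = ?P d"
    using less.prems by (intro ballI less.IH) (auto simp: dvd_pos_nat dest: dvd_imp_le)
  then obtain f :: "nat \<Rightarrow> int poly" where f: "\<And>d. d \<in> ?I \<Longrightarrow> map_poly of_int (f d) = ?P d"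
    by metis
  define Q where "Q = (\<Prod>d\<in>?I. f d)"
  have mapQ: "map_poly of_int Q = (\<Prod>d\<in>?I. ?P d)"
    using f by (simp add: Q_def of_int_poly_hom.hom_prod)
  have "lead_coeff (map_poly of_int Q :: complex poly) = 1"
    unfolding mapQ by (simp add: lead_coeff_prod)
  hence monic: "lead_coeff Q = 1" by simp
  obtain q r where qr: "Polynomial.monom 1 h - 1 = Q * q + r" "r = 0 \<or> degree r < degree Q"
    using monic_division[OF monic] .
  have fin: "finite {d. d dvd h}" using less.prems by simp
  let ?h = "map_poly of_int :: int poly \<Rightarrow> complex poly"
  have "?h Q * ?h q + ?h r = ?h (Polynomial.monom 1 h - 1)"
    unfolding qr(1) by (simp add: of_int_poly_hom.hom_add of_int_poly_hom.hom_mult)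
  also have "\<dots> = Polynomial.monom 1 h - 1"
    by (simp add: of_int_poly_hom.hom_minus)
  also have "\<dots> = (\<Prod>d | d dvd h. ?P d)" using prod_prim_roots[OF less.prems] by simp
  also have "\<dots> = ?P h * ?h Q" unfolding mapQ by (rule prod.remove[OF fin]) simp
  \<comment> \<open>The remainder is a multiple of \<open>Q\<close> of smaller degree or zero, so
    the second factor vanishes.\<close>
  finally have eq: "?h r = ?h Q * (?P h - ?h q)" by (simp add: algebra_simps)
  have "?P h - ?h q = 0"
  proof (rule ccontr)
    assume ne: "?P h - ?h q \<noteq> 0"
    have "?h Q \<noteq> 0" using monic by auto
    hence "degree (?h r) = degree (?h Q) + degree (?P h - ?h q)" "?h r \<noteq> 0"
      using ne unfolding eq by (auto simp: degree_mult_eq)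
    thus False using qr(2) by auto
  qed
  thus ?case by (metis right_minus_eq)
qed

definition cyclotomic :: "nat \<Rightarrow> int poly" where
  "cyclotomic h = (SOME f. map_poly of_int f = (\<Prod>z | prim_root h z. [:-z, 1 :: complex:]))"

lemma map_cyclotomic:
  "h > 0 \<Longrightarrow> map_poly of_int (cyclotomic h) = (\<Prod>z | prim_root h z. [:-z, 1 :: complex:])"
  unfolding cyclotomic_def using someI_ex[OF ex_cyclotomic] .

lemma monic_cyclotomic:
  assumes "h > 0"
  shows "lead_coeff (cyclotomic h) = 1"
proof -
  have "lead_coeff (map_poly of_int (cyclotomic h) :: complex poly) = 1"
    unfolding map_cyclotomic[OF assms] by (simp add: lead_coeff_prod)
  thus ?thesis by simp
qed

lemma degree_cyclotomic_pos:
  assumes "h > 0"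
  shows "degree (cyclotomic h) > 0"
proof -
  have "degree (map_poly of_int (cyclotomic h) :: complex poly) = card {z :: complex. prim_root h z}"
    unfolding map_cyclotomic[OF assms] by (subst degree_prod_eq_sum_degree) auto
  moreover obtain z :: complex where "prim_root h z" using ex_prim_root_complex[OF assms] .
  ultimately show ?thesis using card_prim_roots(1)[OF assms] by (auto simp: card_gt_0_iff)
qed

lemma prod_cyclotomic:
  assumes "h > 0"
  shows "(\<Prod>d | d dvd h. cyclotomic d) = Polynomial.monom 1 h - 1"
proof -
  let ?h = "map_poly of_int :: int poly \<Rightarrow> complex poly"
  have "?h (\<Prod>d | d dvd h. cyclotomic d) = (\<Prod>d | d dvd h. ?h (cyclotomic d))"
    by (rule of_int_poly_hom.hom_prod)
  also have "\<dots> = (\<Prod>d | d dvd h. \<Prod>z | prim_root d z. [:-z, 1:])"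
    using assms by (intro prod.cong refl map_cyclotomic) (auto simp: dvd_pos_nat)
  also have "\<dots> = Polynomial.monom 1 h - 1" by (rule prod_prim_roots[OF assms])
  also have "\<dots> = ?h (Polynomial.monom 1 h - 1)" by (simp add: of_int_poly_hom.hom_minus)
  finally show ?thesis by simp
qed

text \<open>An identity of integer polynomials survives in every characteristic.\<close>

lemma unity_root_eq_prod_cyclotomic:
  fixes w :: "'a::field"
  assumes "h > 0"
  shows "w ^ h - 1 = (\<Prod>d | d dvd h. poly (map_poly of_int (cyclotomic d)) w)"
proof -
  have "(\<Prod>d | d dvd h. poly (map_poly of_int (cyclotomic d)) w)
      = poly (map_poly of_int (\<Prod>d | d dvd h. cyclotomic d)) w"
    by (simp add: of_int_poly_hom.hom_prod poly_prod)
  also have "\<dots> = w ^ h - 1"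
    unfolding prod_cyclotomic[OF assms] by (simp add: of_int_poly_hom.hom_minus poly_monom)
  finally show ?thesis by simp
qed

text \<open>Some factor with \<open>d dvd h\<close> vanishes at \<open>w\<close>; then
  \<open>w ^ d = 1\<close>, so \<open>h dvd d\<close> and \<open>d = h\<close>.\<close>

lemma cyclotomic_root:
  fixes w :: "'a::field"
  assumes "h > 0" "prim_root h w"
  shows "poly (map_poly of_int (cyclotomic h)) w = 0"
proof -
  have "(\<Prod>d | d dvd h. poly (map_poly of_int (cyclotomic d)) w) = 0"
    using unity_root_eq_prod_cyclotomic[OF assms(1), of w] assms(2) by (simp add: prim_root_def)
  then obtain d where d: "d dvd h" "poly (map_poly of_int (cyclotomic d)) w = 0"
    using assms(1) by auto
  have "d > 0" using dvd_pos_nat[OF assms(1) d(1)] .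
  hence "(\<Prod>e | e dvd d. poly (map_poly of_int (cyclotomic e)) w) = 0"
    using d(2) by (intro prod_zero bexI[of _ d]) auto
  hence "w ^ d - 1 = 0" using unity_root_eq_prod_cyclotomic[OF \<open>d > 0\<close>, of w] by simp
  hence "h dvd d" using prim_root_power_eq_1_iff[OF assms(2,1)] by simp
  hence "d = h" using d(1) by (rule dvd_antisym[rotated])
  thus ?thesis using d by simp
qed

section \<open>Two roots of unity with sum 1\<close>

text \<open>Multiplication by \<open>u\<close> permutes \<open>H\<close>, so the product of all
  elements is multiplied by \<open>u ^ card H\<close> and yet unchanged.\<close>

lemma power_card_eq_1:
  fixes H :: "'a::field set"
  assumes "finite H" "0 \<notin> H" "\<And>u v. u \<in> H \<Longrightarrow> v \<in> H \<Longrightarrow> u * v \<in> H" "u \<in> H"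
  shows "u ^ card H = 1"
proof -
  have u: "u \<noteq> 0" using assms by auto
  have inj: "inj_on (\<lambda>v. u * v) H" using u by (auto intro: inj_onI)
  hence "(\<lambda>v. u * v) ` H = H" using assms by (intro endo_inj_surj) auto
  hence "\<Prod>H = (\<Prod>v\<in>H. u * v)" using prod.reindex[OF inj, of "\<lambda>v. v"] by simp
  also have "\<dots> = u ^ card H * \<Prod>H" by (simp add: prod.distrib)
  finally show ?thesis using assms(1,2) by (auto simp: prod_zero_iff)
qed

text \<open>
  An element of smaller order than \<open>card H\<close> is a root of the product of the cyclotomic polynomials
  of the proper divisors of \<open>card H\<close>, whose degree is less than \<open>card H\<close>.
\<close>

lemma finite_field_subgroup_cyclic:
  fixes H :: "'a::field set"
  assumes "finite H" "0 \<notin> H" "\<And>u v. u \<in> H \<Longrightarrow> v \<in> H \<Longrightarrow> u * v \<in> H" "H \<noteq> {}"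
  shows "\<exists>w\<in>H. prim_root (card H) w"
proof (rule ccontr)
  assume none: "\<not> (\<exists>w\<in>H. prim_root (card H) w)"
  define h where "h = card H"
  have h: "h > 0" using assms by (simp add: h_def card_gt_0_iff)
  have pos: "d > 0" if "d dvd h" for d using dvd_pos_nat[OF h that] .
  define I where "I = {d. d dvd h} - {h}"
  define Q where "Q = (\<Prod>d\<in>I. cyclotomic d)"
  have I: "finite {d. d dvd h}" "finite I" using h by (auto simp: I_def)
  have monic: "lead_coeff Q = 1" using pos
    by (auto simp: Q_def I_def lead_coeff_prod monic_cyclotomic intro!: prod.neutral)
  hence Q: "Q \<noteq> 0" by auto
  \<comment> \<open>A monic polynomial does not vanish modulo the characteristic.\<close>
  have ne: "map_poly of_int Q \<noteq> (0 :: 'a poly)"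
  proof
    assume "map_poly of_int Q = (0 :: 'a poly)"
    hence "of_int (lead_coeff Q) = (0 :: 'a)" by (metis coeff_0 coeff_map_poly of_int_0)
    thus False using monic by simp
  qed
  have "cyclotomic h * Q = Polynomial.monom 1 h - 1"
    unfolding Q_def I_def prod_cyclotomic[OF h, symmetric]
    by (rule prod.remove[symmetric]) (use I in auto)
  moreover have "cyclotomic h \<noteq> 0" using degree_cyclotomic_pos[OF h] by auto
  ultimately have "degree (cyclotomic h) + degree Q = h"
    using Q degree_monom_minus_one[OF h, where ?'a = int] by (metis degree_mult_eq)
  hence deg: "degree Q < h" using degree_cyclotomic_pos[OF h] by simp
  have "poly (map_poly of_int Q) u = 0" if u: "u \<in> H" for u
  proof -
    have "u ^ h = 1" unfolding h_def using assms u by (intro power_card_eq_1)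
    then obtain d where d: "d > 0" "d dvd h" "prim_root d u" using ex_prim_root_dvd h by blast
    have "d \<in> I" using d none u by (auto simp: I_def h_def)
    moreover have "poly (map_poly of_int (cyclotomic d)) u = 0"
      using d by (intro cyclotomic_root)
    ultimately show ?thesis using I(2)
      by (auto simp: Q_def of_int_poly_hom.hom_prod poly_prod)
  qed
  hence "h \<le> card {u. poly (map_poly of_int Q) u = (0 :: 'a)}"
    unfolding h_def using ne by (intro card_mono poly_roots_finite) auto
  also have "\<dots> \<le> degree (map_poly of_int Q :: 'a poly)" using ne by (rule card_poly_roots_bound)
  also have "\<dots> \<le> degree Q" by (rule degree_map_poly_le)
  finally show False using deg by simp
qed

text \<open>From \<open>norm (1 - t) = 1\<close> and \<open>norm t = 1\<close> follows
  \<open>t + cnj t = 1\<close>; multiplying by \<open>t\<close> gives the equation.\<close>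

lemma unit_complex_sum_eq_1:
  fixes t s :: complex
  assumes "norm t = 1" "norm s = 1" "t + s = 1"
  shows "t\<^sup>2 - t + 1 = 0"
proof -
  have t: "t * cnj t = 1" and s: "s * cnj s = 1"
    using assms complex_norm_square[of t] complex_norm_square[of s] by simp_all
  have s_eq: "s = 1 - t" using assms(3) by (simp add: algebra_simps)
  have "(1 - t) * (1 - cnj t) = 1" using s unfolding s_eq by simp
  hence "t + cnj t = 1" using t by (simp add: algebra_simps)
  hence "t * (t + cnj t) = t" by simp
  thus ?thesis using t by (simp add: algebra_simps power2_eq_square)
qed

lemma unity_roots_sum_eq_1:
  fixes x :: "'a::field"
  assumes N: "N > 0" and xN: "x ^ N = 1" and yN: "(1 - x) ^ N = 1"
    and char: "CHAR('a) = 0 \<or> CHAR('a) > 3 ^ totient N"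
  shows "x\<^sup>2 - x + 1 = 0"
proof -
  define y where "y = 1 - x"
  have yN: "y ^ N = 1" using yN by (simp add: y_def)
  \<comment> \<open>The group generated by \<open>x\<close> and \<open>y\<close>; exponents below
    \<open>N\<close> suffice since both \<open>N\<close>-th powers are 1.\<close>
  define H where "H = (\<lambda>(a, b). x ^ a * y ^ b) ` ({..<N} \<times> {..<N})"
  have x0: "x \<noteq> 0" and y0: "y \<noteq> 0" using xN yN N by (auto simp: power_0_left)
  have mem: "x ^ a * y ^ b \<in> H" for a b
  proof -
    have "u ^ a = u ^ (a mod N)" if "u ^ N = 1" for u :: 'a and a
    proof -
      have "u ^ a = u ^ (N * (a div N) + a mod N)" by simp
      also have "\<dots> = u ^ (a mod N)" by (simp only: power_add power_mult that power_one mult_1)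
      finally show ?thesis .
    qed
    hence "x ^ a * y ^ b = x ^ (a mod N) * y ^ (b mod N)" using xN yN by metis
    thus ?thesis unfolding H_def using N by (intro image_eqI[of _ _ "(a mod N, b mod N)"]) auto
  qed
  have H: "finite H" "0 \<notin> H" "H \<noteq> {}" using x0 y0 N by (auto simp: H_def)
  have H_mult: "u * v \<in> H" if uv: "u \<in> H" "v \<in> H" for u v
  proof -
    obtain a b c d where "u = x ^ a * y ^ b" "v = x ^ c * y ^ d"
      using uv by (auto simp: H_def)
    hence "u * v = x ^ (a + c) * y ^ (b + d)" by (simp add: power_add mult_ac)
    thus ?thesis using mem by simp
  qed
  define h where "h = card H"
  have h: "h > 0" using H by (simp add: h_def card_gt_0_iff)
  obtain w where w: "w \<in> H" "prim_root h w"
    using finite_field_subgroup_cyclic[OF H(1,2) H_mult H(3)] by (auto simp: h_def)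
  have "x \<in> H" "y \<in> H" using mem[of 1 0] mem[of 0 1] by simp_all
  hence "x ^ h = 1" "y ^ h = 1" unfolding h_def using H H_mult by (auto intro: power_card_eq_1)
  then obtain i j where ij: "x = w ^ i" "y = w ^ j"
    using unity_roots_eq_powers[OF w(2) h] by (auto simp: set_eq_iff image_iff)
  obtain a b where "w = x ^ a * y ^ b" using w(1) by (auto simp: H_def)
  hence "w ^ N = (x ^ N) ^ a * (y ^ N) ^ b"
    by (simp add: power_mult_distrib power_mult[symmetric] mult.commute)
  hence "w ^ N = 1" using xN yN by simp
  hence "h dvd N" using prim_root_power_eq_1_iff[OF w(2) h] by simp
  hence tot: "totient h \<le> totient N" using N by (rule totient_dvd_mono)

  \<comment> \<open>\<open>w\<close> is a root of \<open>g\<close> because \<open>x + y = 1\<close>;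
    the same exponents make sense for complex roots of unity.\<close>
  define g :: "int poly" where "g = 1 - Polynomial.monom 1 i - Polynomial.monom 1 j"
  have g: "poly (map_poly of_int g) u = 1 - u ^ i - u ^ j" for u :: "'b::field"
    by (simp add: g_def of_int_poly_hom.hom_minus poly_monom)
  let ?S = "{z :: complex. prim_root h z}"
  obtain M :: int where M': "of_int M = (\<Prod>z\<in>?S. poly (map_poly of_int g) z)"
    and M0: "\<forall>u :: 'a. poly (map_poly of_int (cyclotomic h)) u = 0 \<longrightarrow>
      poly (map_poly of_int g) u = 0 \<longrightarrow> of_int M = (0 :: 'a)"
    using integer_norm[OF monic_cyclotomic[OF h] card_prim_roots(1)[OF h] map_cyclotomic[OF h],
        of g, where ?'a = 'a] by (elim exE conjE)
  have M: "of_int M = (\<Prod>z\<in>?S. 1 - z ^ i - z ^ j)" unfolding M' g ..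
  have "poly (map_poly of_int g) w = 0" using ij by (simp add: g y_def[symmetric]) (simp add: y_def)
  hence "of_int M = (0 :: 'a)" using M0 cyclotomic_root[OF h w(2)] by simp
  hence dvd: "int CHAR('a) dvd M" by (simp add: of_int_eq_0_iff_char_dvd)

  have norm_z: "norm (z ^ k) = 1" if "z \<in> ?S" for z k
  proof -
    have "norm z ^ h = 1" using that by (simp add: prim_root_def norm_power[symmetric])
    hence "norm z = 1" using h power_eq_imp_eq_base[of "norm z" h 1] by simp
    thus ?thesis by (simp add: norm_power)
  qed
  have "norm (1 - z ^ i - z ^ j) \<le> 3" if "z \<in> ?S" for z
    using norm_triangle_ineq4[of "1 - z ^ i" "z ^ j"] norm_triangle_ineq4[of 1 "z ^ i"]
      norm_z[OF that, of i] norm_z[OF that, of j] by simp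
  hence "norm (\<Prod>z\<in>?S. 1 - z ^ i - z ^ j) \<le> (\<Prod>z\<in>?S. 3)"
    unfolding prod_norm[symmetric] by (intro prod_mono) auto
  also have "\<dots> = (3 :: real) ^ card ?S" by simp
  also have "\<dots> \<le> 3 ^ totient N" using card_prim_roots(2)[OF h] tot by (intro power_increasing) auto
  finally have "real_of_int \<bar>M\<bar> \<le> 3 ^ totient N"
    unfolding M[symmetric] by simp
  hence bound: "\<bar>M\<bar> \<le> int (3 ^ totient N)" using of_int_le_iff[of "\<bar>M\<bar>" "3 ^ totient N", where ?'a = real] by simp
  \<comment> \<open>A nonzero multiple of the characteristic cannot be this small; in characteristic
    0 divisibility alone gives the claim.\<close>
  have "M = 0"
  proof (rule ccontr)
    assume "M \<noteq> 0"
    hence "CHAR('a) \<noteq> 0" using dvd by auto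
    hence "3 ^ totient N < CHAR('a)" using char by simp
    moreover have "CHAR('a) \<le> 3 ^ totient N"
      using order_trans[OF dvd_imp_le_int[OF \<open>M \<noteq> 0\<close> dvd] bound]
      by (simp only: abs_of_nat of_nat_le_iff)
    ultimately show False by simp
  qed
  hence "\<exists>z\<in>?S. 1 - z ^ i - z ^ j = 0" using M card_prim_roots(1)[OF h] by auto
  then obtain z where z: "z \<in> ?S" "1 - z ^ i - z ^ j = 0" by blast
  define t where "t = z ^ i"
  have t: "t\<^sup>2 - t + 1 = 0"
    using unit_complex_sum_eq_1[OF norm_z[OF z(1), of i] norm_z[OF z(1), of j]] z(2)
    by (simp add: t_def algebra_simps)
  \<comment> \<open>Sums do not carry over between the fields, but orders do: \<open>w\<close> and
    \<open>z\<close> both have order \<open>h\<close>, and \<open>x\<close> and \<open>t\<close> are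
    their \<open>i\<close>-th powers.\<close>
  have transfer: "x ^ e = 1 \<longleftrightarrow> t ^ e = 1" for e
    using z(1) prim_root_power_eq_1_iff[OF w(2) h, of "i * e"]
      prim_root_power_eq_1_iff[of h z "i * e"] h by (simp add: ij t_def power_mult)
  have t2: "t\<^sup>2 = t - 1" using t by (simp add: algebra_simps)
  have "t ^ 3 + 1 = (t + 1) * (t\<^sup>2 - t + 1)"
    by (simp add: power3_eq_cube power2_eq_square algebra_simps)
  hence t3: "t ^ 3 = - 1" using t by (simp add: eq_neg_iff_add_eq_0)
  have "t ^ 6 = 1" using t3 power_mult[of t 3 2] by simp
  moreover have "t ^ 3 \<noteq> 1" using t3 by simp
  moreover have "t\<^sup>2 \<noteq> 1"
  proof
    assume "t\<^sup>2 = 1"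
    hence "t = 2" using t2 by simp
    thus False using \<open>t\<^sup>2 = 1\<close> by simp
  qed
  ultimately have x: "x ^ 6 = 1" "x ^ 3 \<noteq> 1" "x\<^sup>2 \<noteq> 1" using transfer by blast+
  \<comment> \<open>Since \<open>x\<close> has order 6, this factorisation leaves only the quadratic
    factor.\<close>
  have "(x ^ 3 - 1) * (x + 1) * (x\<^sup>2 - x + 1) = x ^ 6 - 1"
    by (simp add: algebra_simps power2_eq_square power3_eq_cube eval_nat_numeral)
  hence "x + 1 = 0 \<or> x\<^sup>2 - x + 1 = 0" using x by auto
  moreover have "x + 1 \<noteq> 0"
  proof
    assume "x + 1 = 0"
    hence "x = - 1" by (rule eq_neg_iff_add_eq_0[THEN iffD2])
    thus False using x(3) by simp
  qed
  ultimately show ?thesis by blast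
qed

section \<open>Nonexistence of 5-nets\<close>

theorem theorem5p2:
  fixes n :: nat
  assumes "n \<ge> 2"
    and "CHAR('a::field) = 0 \<or> CHAR('a) > 3 ^ totient (n\<^sup>2 - n)"
  shows "\<not> (\<exists>lam :: nat \<Rightarrow> ('a ^ 3) set set. embedded_net 5 n lam)"
proof
  assume "\<exists>lam :: nat \<Rightarrow> ('a ^ 3) set set. embedded_net 5 n lam"
  then obtain lam :: "nat \<Rightarrow> ('a ^ 3) set set" where "embedded_net 5 n lam" ..
  then interpret net 5 n lam using assms(1) by unfold_locales simp_all
  obtain P where P: "P \<in> net_points" using net_points_nonempty by auto
  have "n * 2 \<le> n * n" using assms(1) by (intro mult_le_mono2)
  \<comment> \<open>The exponent must be positive, which fails for orders 0 and 1.\<close>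
  hence N: "n\<^sup>2 - n > 0" using assms(1) by (simp add: power2_eq_square)
  have root: "(cross i j a b P)\<^sup>2 - cross i j a b P + 1 = 0"
    if ijab: "i < 5" "j < 5" "a < 5" "b < 5" "distinct [i, j, a, b]" for i j a b
  proof (rule unity_roots_sum_eq_1[OF N _ _ assms(2)])
    show "cross i j a b P ^ (n\<^sup>2 - n) = 1" using ijab P by (intro cross_power) auto
    have "1 - cross i j a b P = cross i b a j P"
      using cross_add[OF ijab P] by (simp add: eq_diff_eq diff_eq_eq add.commute)
    also have "\<dots> ^ (n\<^sup>2 - n) = 1" using ijab P by (intro cross_power) auto
    finally show "(1 - cross i j a b P) ^ (n\<^sup>2 - n) = 1" .
  qed
  \<comment> \<open>All five components enter: the three cross-ratios share components 0 and 1 and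
    use the pairs 2,3 and 3,4 and 2,4.\<close>
  define u where "u = cross 0 1 2 3 P"
  define v where "v = cross 0 1 3 4 P"
  have uv: "u * v = cross 0 1 2 4 P" unfolding u_def v_def using P by (intro cross_mult) auto
  have u: "u\<^sup>2 - u + 1 = 0" and v: "v\<^sup>2 - v + 1 = 0"
    unfolding u_def v_def by (rule root; simp)+
  have w: "(u * v)\<^sup>2 - u * v + 1 = 0" unfolding uv by (rule root; simp)
  have "u\<^sup>2 = u - 1" "v\<^sup>2 = v - 1" using u v by (simp_all add: algebra_simps eq_diff_eq)
  hence "(u - 1) * (v - 1) - u * v + 1 = 0" using w by (simp add: power_mult_distrib)
  hence v_eq: "v = 2 - u" by (simp add: algebra_simps)
  \<comment> \<open>With \<open>v = 2 - u\<close>, subtracting the two quadratic equations leaves a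
    linear one.\<close>
  have "2 * (1 - u) = (v\<^sup>2 - v + 1) - (u\<^sup>2 - u + 1)"
    unfolding v_eq by (simp add: power2_eq_square algebra_simps)
  hence "2 * (1 - u) = 0" using u v by simp
  moreover have "u \<noteq> 1" using u by auto
  ultimately have "(2 :: 'a) = 0" by simp
  hence "of_nat 2 = (0 :: 'a)" by simp
  hence dvd: "CHAR('a) dvd 2" by (simp only: of_nat_eq_0_iff_char_dvd)
  \<comment> \<open>The bound on the characteristic is at least 3, which excludes characteristic
    2.\<close>
  have "totient (n\<^sup>2 - n) > 0" using N by simp
  hence "3 \<le> (3::nat) ^ totient (n\<^sup>2 - n)" by (intro self_le_power) simp_all
  moreover have "CHAR('a) \<noteq> 0" "CHAR('a) \<le> 2"
    using dvd_pos_nat[OF _ dvd] dvd_imp_le[OF dvd] by simp_all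
  ultimately show False using assms(2) by simp
qed

end
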